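(* Let $G$ be a group acting on $\mathbb{C}^n$ through a unitary representation. Let $H:\mathbb{C}^n\to\mathbb{C}^N$ be a $G$-invariant map satisfying the non-parallel property, and assume $H$ is $C^1$. Then the map $\Phi_H:\mathbb{C}^n\to\mathbb{C}^N$ defined by $\Phi_H(x)=\|x\|\,H\!\left(\frac{x}{\|x\|}\right)$ for $x\neq 0$ and $\Phi_H(0)=0$ is Lipschitz. Furthermore, the optimal constant $\alpha$ such that $$\|\tilde\Phi_H([x])-\tilde\Phi_H([y])\|\le \alpha\, d_G([x],[y])\quad\text{for all }x,y\in\mathbb{C}^n$$ satisfies $\alpha\le 3C$, where $$C=\max\left\{\|\nabla_{\mathbb{S}}H\|_\infty,\ \max_{z\in\mathbb{S}}\|H(z)\|\right\}.$$
   Context: A unitary representation of $G$ on $\mathbb{C}^n$ is a group homomorphism $\sigma:G\to U(n)$; it gives the action $gx=\sigma(g)x$. $\mathbb{C}^n/G$ is the space of orbits, $[x]$ is the orbit of $x$, and $d_G([x],[y])=\inf_{g\in G}\|x-gy\|$ with the Euclidean norm. A map $\Phi$ on $\mathbb{C}^n$ is $G$-invariant if $\Phi(gx)=\Phi(x)$ for all $g,x$; it then induces $\tilde\Phi([x])=\Phi(x)$ on $\mathbb{C}^n/G$ (the map $\Phi_H$ is $G$-invariant because $H$ is and $G$ acts unitarily). A $G$-invariant map $F:\mathbb{C}^n\to\mathbb{C}^N$ has the non-parallel property if the following holds: whenever $\|x\|=\|y\|=1$ and $F(x)=\lambda F(y)$ for some real $\lambda>0$, then $x=gy$ for some $g\in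 G$. $\mathbb{S}$ is the unit sphere of $\mathbb{C}^n$. $C^1$ is meant in the real sense ($\mathbb{C}^n\cong\mathbb{R}^{2n}$). $\nabla_{\mathbb{S}}H$ is the differential of the restriction $H|_{\mathbb{S}}$ (acting on tangent vectors of $\mathbb{S}$), and $\|\nabla_{\mathbb{S}}H\|_\infty$ is the supremum over $\mathbb{S}$ of its operator norm. *)

theory Defs
  imports "HOL-Analysis.Analysis" "HOL-Algebra.Group_Action"
begin

section \<open>Unitary representations\<close>

definition conj_transpose :: "complex^'n^'m \<Rightarrow> complex^'m^'n" where
  "conj_transpose A = map_matrix cnj (transpose A)"

definition unitary_group :: "(complex^'n^'n) monoid" where
  "unitary_group =
     \<lparr>carrier = {A. conj_transpose A ** A = mat 1 \<and> A ** conj_transpose A = mat 1},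
      mult = (**), one = mat 1\<rparr>"

abbreviation rep_orbit ::
    "('g, 'b) monoid_scheme \<Rightarrow> ('g \<Rightarrow> complex^'n^'n) \<Rightarrow> complex^'n \<Rightarrow> (complex^'n) set" where
  "rep_orbit G \<sigma> x \<equiv> orbit G (\<lambda>g. (*v) (\<sigma> g)) x"

text \<open>The orbit distance and the induced map are functions on orbits. The sets to which
  \<open>the_elem\<close> is applied are singletons, see \<open>orbit_dist_rep_orbit\<close> and
  \<open>induced_map_rep_orbit\<close> below.\<close>

definition orbit_dist ::
    "('g, 'b) monoid_scheme \<Rightarrow> ('g \<Rightarrow> complex^'n^'n) \<Rightarrow> (complex^'n) set \<Rightarrow> (complex^'n) set \<Rightarrow> real"
where
  "orbit_dist G \<sigma> A B =
     the_elem ((\<lambda>(x, y). INF g\<in>carrier G. norm (x - \<sigma> g *v y)) ` (A \<times> B))"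

definition induced_map :: "(complex^'n \<Rightarrow> 'c) \<Rightarrow> (complex^'n) set \<Rightarrow> 'c" where
  "induced_map \<Phi> A = the_elem (\<Phi> ` A)"

definition invariant_map ::
    "('g, 'b) monoid_scheme \<Rightarrow> ('g \<Rightarrow> complex^'n^'n) \<Rightarrow> (complex^'n \<Rightarrow> 'c) \<Rightarrow> bool" where
  "invariant_map G \<sigma> \<Phi> \<longleftrightarrow> (\<forall>g\<in>carrier G. \<forall>x. \<Phi> (\<sigma> g *v x) = \<Phi> x)"

definition non_parallel ::
    "('g, 'b) monoid_scheme \<Rightarrow> ('g \<Rightarrow> complex^'n^'n) \<Rightarrow> (complex^'n \<Rightarrow> complex^'m) \<Rightarrow> bool"
where
  "non_parallel G \<sigma> F \<longleftrightarrow>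
     (\<forall>x y (r::real). norm x = 1 \<longrightarrow> norm y = 1 \<longrightarrow> r > 0 \<longrightarrow> F x = r *\<^sub>R F y \<longrightarrow>
        (\<exists>g\<in>carrier G. x = \<sigma> g *v y))"

section \<open>Differentiability in the real sense\<close>

text \<open>\<open>has_derivative\<close> and \<open>\<Rightarrow>\<^sub>L\<close> refer to the real vector space structure,
  and \<open>\<bullet>\<close> on \<open>complex^'n\<close> is the real inner product (the real part of the Hermitian one).\<close>

definition C1_map :: "(complex^'n \<Rightarrow> complex^'m) \<Rightarrow> bool" where
  "C1_map H \<longleftrightarrow>
     (\<exists>H' :: complex^'n \<Rightarrow> (complex^'n) \<Rightarrow>\<^sub>L (complex^'m).
        (\<forall>x. (H has_derivative blinfun_apply (H' x)) (at x)) \<and> continuous_on UNIV H')"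

definition sphere_tangent :: "complex^'n \<Rightarrow> (complex^'n) set" where
  "sphere_tangent z = {v. v \<bullet> z = 0}"

text \<open>The differential of the restriction of \<open>H\<close> to the unit sphere is the derivative within the
  sphere. Such a derivative is determined only on tangent vectors (\<open>sphere_derivative_unique\<close>),
  and the operator norm is taken over those only.\<close>

definition sphere_grad_norm :: "(complex^'n \<Rightarrow> complex^'m) \<Rightarrow> complex^'n \<Rightarrow> real" where
  "sphere_grad_norm H z =
     (SUP v\<in>{v \<in> sphere_tangent z. norm v \<le> 1}.
        norm (frechet_derivative H (at z within sphere 0 1) v))"

definition sphere_grad_sup :: "(complex^'n \<Rightarrow> complex^'m) \<Rightarrow> real" where
  "sphere_grad_sup H = (SUP z\<in>sphere 0 1. sphere_grad_norm H z)"

definition sphere_sup :: "(complex^'n \<Rightarrow> complex^'m) \<Rightarrow> real" where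
  "sphere_sup H = (SUP z\<in>sphere 0 1. norm (H z))"

section \<open>The radial extension\<close>

definition radial_ext :: "(complex^'n \<Rightarrow> complex^'m) \<Rightarrow> complex^'n \<Rightarrow> complex^'m" where
  "radial_ext H x = (if x = 0 then 0 else norm x *\<^sub>R H (x /\<^sub>R norm x))"

definition orbit_lipschitz_const ::
    "('g, 'b) monoid_scheme \<Rightarrow> ('g \<Rightarrow> complex^'n^'n) \<Rightarrow> (complex^'n \<Rightarrow> complex^'m) \<Rightarrow> real \<Rightarrow> bool"
where
  "orbit_lipschitz_const G \<sigma> \<Phi> \<alpha> \<longleftrightarrow>
     (\<forall>x y. norm (induced_map \<Phi> (rep_orbit G \<sigma> x) - induced_map \<Phi> (rep_orbit G \<sigma> y))
              \<le> \<alpha> * orbit_dist G \<sigma> (rep_orbit G \<sigma> x) (rep_orbit G \<sigma> y))"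

section \<open>The notions above are well defined\<close>

lemma conj_transpose_mult: "conj_transpose (A ** B) = conj_transpose B ** conj_transpose A"
  by (simp add: conj_transpose_def transpose_def matrix_matrix_mult_def vec_eq_iff mult.commute)

lemma conj_transpose_twice [simp]: "conj_transpose (conj_transpose A) = A"
  by (simp add: conj_transpose_def transpose_def vec_eq_iff)

lemma conj_transpose_mat1 [simp]: "conj_transpose (mat 1) = mat 1"
  by (simp add: conj_transpose_def transpose_def mat_def vec_eq_iff)

lemma group_unitary_group: "group (unitary_group :: (complex^'n^'n) monoid)"
proof (rule groupI)
  fix A B :: "complex^'n^'n"
  assume "A \<in> carrier unitary_group" "B \<in> carrier unitary_group"
  then have 1: "conj_transpose A ** A = mat 1" "A ** conj_transpose A = mat 1"
     "conj_transpose B ** B = mat 1" "B ** conj_transpose B = mat 1"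
    by (auto simp: unitary_group_def)
  have "conj_transpose B ** conj_transpose A ** (A ** B)
      = conj_transpose B ** (conj_transpose A ** A) ** B"
    "A ** B ** (conj_transpose B ** conj_transpose A)
      = A ** (B ** conj_transpose B) ** conj_transpose A"
    by (simp_all only: matrix_mul_assoc)
  with 1 show "A \<otimes>\<^bsub>unitary_group\<^esub> B \<in> carrier unitary_group"
    by (simp add: unitary_group_def conj_transpose_mult)
next
  fix A :: "complex^'n^'n"
  assume "A \<in> carrier unitary_group"
  then show "\<exists>B\<in>carrier unitary_group. B \<otimes>\<^bsub>unitary_group\<^esub> A = \<one>\<^bsub>unitary_group\<^esub>"
    by (intro bexI[of _ "conj_transpose A"]) (auto simp: unitary_group_def)
qed (auto simp: unitary_group_def matrix_mul_assoc)

lemma norm_unitary: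
  fixes A :: "complex^'n^'n"
  assumes "A \<in> carrier unitary_group"
  shows "norm (A *v x) = norm x"
proof -
  have sq: "complex_of_real ((norm v)\<^sup>2) = (\<Sum>i\<in>UNIV. v $ i * cnj (v $ i))" for v :: "complex^'n"
    by (simp add: norm_vec_def L2_set_def sum_nonneg flip: complex_norm_square)
  have A: "conj_transpose A ** A = mat 1"
    using assms by (simp add: unitary_group_def)
  have "(\<Sum>i\<in>UNIV. (A *v x) $ i * cnj ((A *v x) $ i))
      = (\<Sum>i\<in>UNIV. \<Sum>j\<in>UNIV. \<Sum>k\<in>UNIV. cnj (A $ i $ k) * A $ i $ j * (x $ j * cnj (x $ k)))"
    by (simp add: matrix_vector_mult_def sum_product cnj_sum mult_ac)
  also have "\<dots> = (\<Sum>j\<in>UNIV. \<Sum>k\<in>UNIV. \<Sum>i\<in>UNIV. cnj (A $ i $ k) * A $ i $ j * (x $ j * cnj (x $ k)))"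
    by (subst sum.swap) (intro sum.cong refl sum.swap)
  also have "\<dots> = (\<Sum>j\<in>UNIV. \<Sum>k\<in>UNIV. (conj_transpose A ** A) $ k $ j * (x $ j * cnj (x $ k)))"
    by (simp add: matrix_matrix_mult_def conj_transpose_def transpose_def sum_distrib_right)
  also have "\<dots> = (\<Sum>j\<in>UNIV. x $ j * cnj (x $ j))"
    by (simp add: A mat_def if_distrib[where f="\<lambda>c. c * _"] cong: if_cong)
  finally have "complex_of_real ((norm (A *v x))\<^sup>2) = complex_of_real ((norm x)\<^sup>2)"
    by (simp only: sq)
  then have "(norm (A *v x))\<^sup>2 = (norm x)\<^sup>2"
    by (simp only: of_real_eq_iff)
  then show ?thesis
    by simp
qed

context
  fixes G :: "('g, 'b) monoid_scheme" and \<sigma> :: "'g \<Rightarrow> complex^'n^'n"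
  assumes G: "group G" and \<sigma>: "\<sigma> \<in> hom G unitary_group"
begin

interpretation group_hom G unitary_group \<sigma>
  by (intro group_hom.intro group_hom_axioms.intro G \<sigma> group_unitary_group)

lemma rep_mult: "g \<in> carrier G \<Longrightarrow> h \<in> carrier G \<Longrightarrow> \<sigma> (g \<otimes>\<^bsub>G\<^esub> h) *v x = \<sigma> g *v (\<sigma> h *v x)"
  using hom_mult[of g h] by (simp add: unitary_group_def matrix_vector_mul_assoc)

lemma rep_one: "\<sigma> \<one>\<^bsub>G\<^esub> *v x = x"
  using hom_one by (simp add: unitary_group_def)

lemma rep_orbit_self: "x \<in> rep_orbit G \<sigma> x"
  unfolding orbit_def using rep_one[of x, symmetric] G.one_closed by blast

lemma norm_rep: "g \<in> carrier G \<Longrightarrow> norm (\<sigma> g *v x) = norm x"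
  using hom_closed norm_unitary by blast

lemma induced_map_rep_orbit:
  assumes "invariant_map G \<sigma> \<Phi>"
  shows "induced_map \<Phi> (rep_orbit G \<sigma> x) = \<Phi> x"
proof -
  have "\<Phi> ` rep_orbit G \<sigma> x = {\<Phi> x}"
  proof
    show "\<Phi> ` rep_orbit G \<sigma> x \<subseteq> {\<Phi> x}"
      using assms by (auto simp: orbit_def invariant_map_def)
    show "{\<Phi> x} \<subseteq> \<Phi> ` rep_orbit G \<sigma> x"
      using rep_orbit_self[of x] by blast
  qed
  then show ?thesis
    by (simp add: induced_map_def)
qed

lemma invariant_map_radial_ext:
  assumes "invariant_map G \<sigma> H"
  shows "invariant_map G \<sigma> (radial_ext H)"
  unfolding invariant_map_def
proof (intro ballI allI)
  fix g x assume g: "g \<in> carrier G"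
  have "\<sigma> g *v (x /\<^sub>R norm x) = (\<sigma> g *v x) /\<^sub>R norm x"
    by (simp add: matrix_vector_mult_def vec_eq_iff scaleR_sum_right)
  then have "H ((\<sigma> g *v x) /\<^sub>R norm x) = H (x /\<^sub>R norm x)"
    using assms g unfolding invariant_map_def by metis
  moreover have "\<sigma> g *v x = 0 \<longleftrightarrow> x = 0"
    using norm_rep[OF g, of x] by (metis norm_eq_zero)
  ultimately show "radial_ext H (\<sigma> g *v x) = radial_ext H x"
    by (simp add: radial_ext_def norm_rep[OF g])
qed

lemma orbit_dist_rep_orbit:
  "orbit_dist G \<sigma> (rep_orbit G \<sigma> x) (rep_orbit G \<sigma> y) = (INF g\<in>carrier G. norm (x - \<sigma> g *v y))"
proof -
  have eq: "(INF g\<in>carrier G. norm (\<sigma> h *v x - \<sigma> g *v (\<sigma> k *v y)))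
          = (INF g\<in>carrier G. norm (x - \<sigma> g *v y))"
    if h: "h \<in> carrier G" and k: "k \<in> carrier G" for h k
  proof -
    have n: "norm (\<sigma> h *v x - \<sigma> (h \<otimes>\<^bsub>G\<^esub> g) *v y) = norm (x - \<sigma> g *v y)" if "g \<in> carrier G" for g
      using norm_rep[OF h, of "x - \<sigma> g *v y"]
      by (simp only: rep_mult[OF h that] matrix_vector_mult_diff_distrib)
    have "(\<lambda>g. norm (\<sigma> h *v x - \<sigma> g *v (\<sigma> k *v y))) ` carrier G
        = (\<lambda>g. norm (x - \<sigma> g *v y)) ` carrier G" (is "?A = ?B")
    proof
      show "?A \<subseteq> ?B"
      proof
        fix a assume "a \<in> ?A"
        then obtain g where g: "g \<in> carrier G" and a: "a = norm (\<sigma> h *v x - \<sigma> g *v (\<sigma> k *v y))"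
          by auto
        let ?g = "inv\<^bsub>G\<^esub> h \<otimes>\<^bsub>G\<^esub> (g \<otimes>\<^bsub>G\<^esub> k)"
        have "h \<otimes>\<^bsub>G\<^esub> ?g = g \<otimes>\<^bsub>G\<^esub> k"
          using g h k G by (simp add: group.inv_solve_left' flip: G.m_assoc)
        then have "a = norm (x - \<sigma> ?g *v y)"
          using n[of ?g] g h k by (simp only: a rep_mult[OF g k] G.m_closed G.inv_closed)
        then show "a \<in> ?B"
          using g h k by (intro image_eqI[of _ _ ?g]) (simp_all only: G.m_closed G.inv_closed)
      qed
      show "?B \<subseteq> ?A"
      proof
        fix a assume "a \<in> ?B"
        then obtain g where g: "g \<in> carrier G" and a: "a = norm (x - \<sigma> g *v y)"
          by auto
        let ?g = "(h \<otimes>\<^bsub>G\<^esub> g) \<otimes>\<^bsub>G\<^esub> inv\<^bsub>G\<^esub> k"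
        have "?g \<otimes>\<^bsub>G\<^esub> k = h \<otimes>\<^bsub>G\<^esub> g"
          using g h k by (simp add: G.m_assoc)
        then have "a = norm (\<sigma> h *v x - \<sigma> ?g *v (\<sigma> k *v y))"
          using n[OF g] rep_mult[of ?g k y] g h k by (simp only: a G.m_closed G.inv_closed)
        then show "a \<in> ?A"
          using g h k by (intro image_eqI[of _ _ ?g]) (simp_all only: G.m_closed G.inv_closed)
      qed
    qed
    then show ?thesis
      by simp
  qed
  have "(\<lambda>(x, y). INF g\<in>carrier G. norm (x - \<sigma> g *v y)) ` (rep_orbit G \<sigma> x \<times> rep_orbit G \<sigma> y)
      = {INF g\<in>carrier G. norm (x - \<sigma> g *v y)}" (is "?F ` _ = {?d}")
  proof
    show "?F ` (rep_orbit G \<sigma> x \<times> rep_orbit G \<sigma> y) \<subseteq> {?d}"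
      by (auto simp: orbit_def eq)
    have "(x, y) \<in> rep_orbit G \<sigma> x \<times> rep_orbit G \<sigma> y"
      using rep_orbit_self by blast
    then show "{?d} \<subseteq> ?F ` (rep_orbit G \<sigma> x \<times> rep_orbit G \<sigma> y)"
      by force
  qed
  then show ?thesis
    by (simp add: orbit_dist_def)
qed

end

lemma sphere_derivative_unique:
  fixes H :: "complex^'n \<Rightarrow> complex^'m"
  assumes D: "(H has_derivative D) (at z within sphere 0 1)"
    and E: "(H has_derivative E) (at z within sphere 0 1)"
    and z: "norm z = 1" and v: "v \<in> sphere_tangent z"
  shows "D v = E v"
proof (cases "v = 0")
  case True
  then show ?thesis
    using has_derivative_bounded_linear[OF D] has_derivative_bounded_linear[OF E]
    by (simp add: bounded_linear.linear linear_0)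
next
  case False
  define u where "u = v /\<^sub>R norm v"
  define c where "c t = cos t *\<^sub>R z + sin t *\<^sub>R u" for t
  have u: "u \<bullet> u = 1" "u \<bullet> z = 0" "z \<bullet> u = 0" "z \<bullet> z = 1"
    using False v z by (auto simp: u_def sphere_tangent_def dot_square_norm inner_commute power2_eq_square)
  have "c t \<bullet> c t = 1" for t
    using sin_cos_squared_add3[of t] by (simp add: c_def inner_add_left inner_add_right u)
  then have c_sphere: "range c \<subseteq> sphere 0 1"
    by (auto simp: norm_eq_sqrt_inner)
  have c0: "c 0 = z"
    by (simp add: c_def)
  have "(c has_vector_derivative - sin 0 *\<^sub>R z + cos 0 *\<^sub>R u) (at 0)"
    unfolding c_def by (auto intro!: derivative_eq_intros)
  then have c': "(c has_derivative (\<lambda>t. t *\<^sub>R u)) (at 0)"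
    by (simp add: has_vector_derivative_def)
  have chain: "((H \<circ> c) has_vector_derivative F u) (at 0)"
    if F: "(H has_derivative F) (at z within sphere 0 1)" for F
  proof -
    have "(H has_derivative F) (at (c 0) within range c)"
      using has_derivative_subset[OF F c_sphere] by (simp add: c0)
    from diff_chain_within[OF c' this] show ?thesis
      using has_derivative_bounded_linear[OF F]
      by (simp add: has_vector_derivative_def o_def linear_scale bounded_linear.linear)
  qed
  have "D u = E u"
    using vector_derivative_unique_at chain[OF D] chain[OF E] by blast
  then show ?thesis
    using False has_derivative_bounded_linear[OF D] has_derivative_bounded_linear[OF E]
    by (simp add: u_def linear_scale bounded_linear.linear)
qed

lemma frechet_derivative_sphere:
  fixes H :: "complex^'n \<Rightarrow> complex^'m"
  assumes H: "(H has_derivative D) (at z)" and z: "norm z = 1" and v: "v \<in> sphere_tangent z"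
  shows "frechet_derivative H (at z within sphere 0 1) v = D v"
proof -
  have D: "(H has_derivative D) (at z within sphere 0 1)"
    using H has_derivative_at_withinI by blast
  then have "(H has_derivative frechet_derivative H (at z within sphere 0 1)) (at z within sphere 0 1)"
    using differentiableI frechet_derivative_works by blast
  then show ?thesis
    using sphere_derivative_unique D z v by blast
qed

end

theory Submission
  imports Defs
begin

text \<open>Away from the origin \<open>radial_ext H\<close> is differentiable. With \<open>u = x /\<^sub>R norm x\<close>, its derivative
  sends \<open>v\<close> to \<open>(v \<bullet> u) *\<^sub>R H u\<close> plus the differential of \<open>H\<close> at \<open>u\<close> applied to the component of \<open>v\<close>
  tangent to the sphere, so its operator norm is at most \<open>2 C\<close>. The mean value inequality applies on
  every segment that misses the origin; if the segment from \<open>x\<close> to \<open>y\<close> contains it, then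
  \<open>norm (x - y) = norm x + norm y\<close> and the bound \<open>norm (radial_ext H x) \<le> C * norm x\<close> suffices.
  Invariance carries the estimate over to orbits, and the set of admissible constants is closed and
  bounded below, hence has a least element.\<close>

section \<open>Differentiating the radial extension\<close>

text \<open>The product rule gives the projection onto the orthogonal complement of
  \<open>sgn x\<close>, scaled by the inverse norm. Its values are tangent to the sphere at
  \<open>sgn x\<close>, so only tangential derivatives of \<open>H\<close> will enter.\<close>

lemma has_derivative_unit_vector:
  fixes x :: "'a::real_inner"
  assumes "x \<noteq> 0"
  shows "((\<lambda>x. x /\<^sub>R norm x) has_derivative
           (\<lambda>v. (v - (v \<bullet> sgn x) *\<^sub>R sgn x) /\<^sub>R norm x)) (at x)"
proof -
  have "((\<lambda>x. inverse (norm x) *\<^sub>R x) has_derivative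
           (\<lambda>v. inverse (norm x) *\<^sub>R v
              + (- (inverse (norm x) * (v \<bullet> sgn x) * inverse (norm x))) *\<^sub>R x)) (at x)"
    using assms
    by (intro has_derivative_scaleR[OF Deriv.has_derivative_inverse[OF _ has_derivative_norm]
          has_derivative_ident]) auto
  moreover have "inverse (norm x) *\<^sub>R v
        + (- (inverse (norm x) * (v \<bullet> sgn x) * inverse (norm x))) *\<^sub>R x
      = (v - (v \<bullet> sgn x) *\<^sub>R sgn x) /\<^sub>R norm x" for v
  proof -
    have "(v \<bullet> sgn x) *\<^sub>R sgn x = ((v \<bullet> sgn x) * inverse (norm x)) *\<^sub>R x"
      by (simp add: sgn_div_norm)
    then show ?thesis
      by (simp add: scaleR_diff_right)
  qed
  ultimately show ?thesis
    by simp
qed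

text \<open>The factor \<open>norm x\<close> cancels the inverse norm from the derivative of the
  unit vector. The result depends on \<open>x\<close> only through \<open>sgn x\<close>, which makes
  a bound uniform in \<open>x\<close> possible.\<close>

lemma has_derivative_radial_ext:
  assumes H: "(H has_derivative D) (at (sgn x))" and x: "x \<noteq> 0"
  shows "(radial_ext H has_derivative
           (\<lambda>v. (v \<bullet> sgn x) *\<^sub>R H (sgn x) + D (v - (v \<bullet> sgn x) *\<^sub>R sgn x))) (at x)"
proof -
  have lin: "linear D"
    using H has_derivative_linear by blast
  have H1: "(H has_derivative D) (at (x /\<^sub>R norm x))"
    using H by (simp add: sgn_div_norm)
  have "((\<lambda>x. norm x *\<^sub>R H (x /\<^sub>R norm x)) has_derivative
          (\<lambda>v. norm x *\<^sub>R D ((v - (v \<bullet> sgn x) *\<^sub>R sgn x) /\<^sub>R norm x)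
             + (v \<bullet> sgn x) *\<^sub>R H (x /\<^sub>R norm x))) (at x)"
    by (intro has_derivative_scaleR has_derivative_norm[OF x]
        has_derivative_compose[OF has_derivative_unit_vector[OF x] H1])
  then have "((\<lambda>x. norm x *\<^sub>R H (x /\<^sub>R norm x)) has_derivative
          (\<lambda>v. (v \<bullet> sgn x) *\<^sub>R H (sgn x) + D (v - (v \<bullet> sgn x) *\<^sub>R sgn x))) (at x)"
    by (rule has_derivative_eq_rhs)
       (use x in \<open>auto simp: sgn_div_norm linear_scale[OF lin] add.commute\<close>)
  moreover have "radial_ext H = (\<lambda>x. norm x *\<^sub>R H (x /\<^sub>R norm x))"
    by (auto simp: radial_ext_def)
  ultimately show ?thesis
    by simp
qed

text \<open>Pythagoras for the splitting of \<open>v\<close> along the unit vector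
  \<open>u\<close>.\<close>

lemma norm_tangent_component_le:
  fixes u v :: "'a::real_inner"
  assumes "norm u = 1"
  shows "norm (v - (v \<bullet> u) *\<^sub>R u) \<le> norm v"
proof -
  have "u \<bullet> u = 1"
    using assms by (simp add: dot_square_norm)
  then have sq: "(norm (v - (v \<bullet> u) *\<^sub>R u))\<^sup>2 = (norm v)\<^sup>2 - (v \<bullet> u)\<^sup>2"
    by (simp add: power2_norm_eq_inner inner_diff_left inner_diff_right inner_commute[of u v]
        flip: power2_eq_square)
  show ?thesis
    by (rule power2_le_imp_le) (simp_all add: sq)
qed

section \<open>Bounds by the suprema over the sphere\<close>

text \<open>Compactness of the sphere bounds the set of values, so that the real supremum is a
  genuine upper bound.\<close>

lemma norm_le_sphere_sup:
  assumes "C1_map H" and z: "norm z = 1"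
  shows "norm (H z) \<le> sphere_sup H"
proof -
  have "continuous_on (sphere 0 1) H"
    using assms(1) unfolding C1_map_def
    by (meson has_derivative_continuous continuous_at_imp_continuous_on)
  then have "compact ((\<lambda>z. norm (H z)) ` sphere 0 1)"
    by (intro compact_continuous_image continuous_intros compact_sphere)
  then have "bdd_above ((\<lambda>z. norm (H z)) ` sphere 0 1)"
    by (intro bounded_imp_bdd_above compact_imp_bounded)
  then show ?thesis
    unfolding sphere_sup_def by (rule cSUP_upper[rotated]) (use z in simp)
qed

text \<open>Both nested suprema must be shown to be over bounded sets: the inner one by the operator
  norm of the full derivative, the outer one by compactness.\<close>

lemma norm_derivative_le_sphere_grad_sup:
  assumes C1: "C1_map H" and D: "(H has_derivative D) (at z)" and z: "norm z = 1"
    and w: "w \<in> sphere_tangent z"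
  shows "norm (D w) \<le> sphere_grad_sup H * norm w"
proof -
  obtain H' where H': "\<And>x. (H has_derivative blinfun_apply (H' x)) (at x)"
    and cont: "continuous_on UNIV H'"
    using C1 unfolding C1_map_def by blast
  \<comment> \<open>Tangency of \<open>v\<close> matters: the derivative within the sphere is
    guaranteed to agree with \<open>H' y\<close> only on tangent vectors.\<close>
  have le: "norm (frechet_derivative H (at y within sphere 0 1) v) \<le> norm (H' y)"
    if "norm y = 1" "v \<in> sphere_tangent y" "norm v \<le> 1" for y v
  proof -
    have "norm (H' y v) \<le> norm (H' y) * norm v"
      by (rule norm_blinfun)
    also have "\<dots> \<le> norm (H' y)"
      using that by (simp add: mult_left_le)
    finally show ?thesis
      using frechet_derivative_sphere[OF H' that(1,2)] by simp
  qed
  have upper: "norm (D v) \<le> sphere_grad_norm H z"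
    if v: "v \<in> sphere_tangent z" "norm v \<le> 1" for v
  proof -
    have "bdd_above ((\<lambda>v. norm (frechet_derivative H (at z within sphere 0 1) v)) `
            {v \<in> sphere_tangent z. norm v \<le> 1})"
      by (rule bdd_aboveI2[where M="norm (H' z)"]) (use le[OF z] in auto)
    then have "norm (frechet_derivative H (at z within sphere 0 1) v) \<le> sphere_grad_norm H z"
      unfolding sphere_grad_norm_def by (rule cSUP_upper[rotated]) (use v in simp)
    then show ?thesis
      using frechet_derivative_sphere[OF D z v(1)] by simp
  qed
  \<comment> \<open>Continuity of \<open>H'\<close> enters here, giving one bound \<open>M\<close>
    for the whole sphere.\<close>
  have "compact ((\<lambda>y. norm (H' y)) ` sphere 0 1)"
    by (intro compact_continuous_image continuous_intros compact_sphere
        continuous_on_subset[OF cont]) auto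
  then obtain M where M: "\<And>y. norm y = 1 \<Longrightarrow> norm (H' y) \<le> M"
    using compact_imp_bounded bounded_imp_bdd_above unfolding bdd_above_def by fastforce
  have "sphere_grad_norm H y \<le> M" if y: "norm y = 1" for y
  proof -
    have "0 \<in> {v \<in> sphere_tangent y. norm v \<le> 1}"
      by (simp add: sphere_tangent_def)
    then show ?thesis
      unfolding sphere_grad_norm_def using le[OF y] M[OF y]
      by (intro cSUP_least) (blast, force)
  qed
  then have "bdd_above (sphere_grad_norm H ` sphere 0 1)"
    by (intro bdd_aboveI2[where M=M]) simp
  then have sup: "sphere_grad_norm H z \<le> sphere_grad_sup H"
    unfolding sphere_grad_sup_def by (rule cSUP_upper[rotated]) (use z in simp)
  show ?thesis
  proof (cases "w = 0")
    case True
    then show ?thesis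
      using D by (simp add: has_derivative_linear linear_0)
  next
    case False
    \<comment> \<open>The supremum tests only vectors of norm at most 1, so \<open>w\<close> is
      normalised and the estimate is scaled back by linearity.\<close>
    have "norm (D (w /\<^sub>R norm w)) \<le> sphere_grad_sup H"
      using upper[of "w /\<^sub>R norm w"] sup w False by (simp add: sphere_tangent_def)
    moreover have "D (w /\<^sub>R norm w) = D w /\<^sub>R norm w"
      using D by (simp add: has_derivative_linear linear_scale)
    ultimately show ?thesis
      using False by (simp add: field_simps)
  qed
qed

lemma sphere_sup_nonneg:
  fixes H :: "complex^'n \<Rightarrow> complex^'m"
  assumes "C1_map H"
  shows "0 \<le> sphere_sup H"
proof -
  obtain z :: "complex^'n" where "norm z = 1"
    using vector_choose_size[of 1] by auto
  then show ?thesis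
    using norm_le_sphere_sup[OF assms] norm_ge_zero[of "H z"] by (meson order_trans)
qed

lemma norm_radial_ext_le:
  assumes "C1_map H"
  shows "norm (radial_ext H x) \<le> sphere_sup H * norm x"
  using norm_le_sphere_sup[OF assms, of "x /\<^sub>R norm x"]
  by (simp add: radial_ext_def mult.commute mult_right_mono)

section \<open>The Lipschitz estimate before passing to orbits\<close>

lemma norm_radial_ext_diff_le:
  fixes H :: "complex^'n \<Rightarrow> complex^'m"
  assumes C1: "C1_map H"
  shows "norm (radial_ext H x - radial_ext H y)
           \<le> 2 * max (sphere_grad_sup H) (sphere_sup H) * norm (x - y)"
proof -
  define C where "C = max (sphere_grad_sup H) (sphere_sup H)"
  have C: "0 \<le> C" "sphere_grad_sup H \<le> C" "sphere_sup H \<le> C"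
    using sphere_sup_nonneg[OF C1] by (auto simp: C_def)
  show ?thesis
  proof (cases "0 \<in> closed_segment x y")
    case True
    then have "norm x + norm y = norm (x - y)"
      using between[of x y 0] by (simp add: between_mem_segment dist_norm)
    moreover have "norm (radial_ext H z) \<le> C * norm z" for z
      using norm_radial_ext_le[OF C1, of z] mult_right_mono[OF C(3), of "norm z"] by simp
    then have "norm (radial_ext H x - radial_ext H y) \<le> C * norm x + C * norm y"
      by (meson add_mono norm_triangle_le_diff)
    ultimately have "norm (radial_ext H x - radial_ext H y) \<le> C * norm (x - y)"
      by (simp flip: distrib_left)
    \<comment> \<open>Here \<open>C\<close> already suffices; it is doubled to match the other
      case.\<close>
    also have "\<dots> \<le> 2 * C * norm (x - y)"
      using C(1) by (intro mult_right_mono) auto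
    finally show ?thesis
      by (simp add: C_def)
  next
    case False
    obtain H' where H': "\<And>x. (H has_derivative blinfun_apply (H' x)) (at x)"
      using C1 unfolding C1_map_def by blast
    define D where "D z v = (v \<bullet> sgn z) *\<^sub>R H (sgn z) + H' (sgn z) (v - (v \<bullet> sgn z) *\<^sub>R sgn z)"
      for z v
    have der: "(radial_ext H has_derivative D z) (at z within closed_segment x y)"
      if "z \<in> closed_segment x y" for z
      unfolding D_def
      by (rule has_derivative_at_withinI, rule has_derivative_radial_ext[OF H'])
         (use that False in auto)
    \<comment> \<open>One \<open>C\<close> comes from the radial term through
      \<open>sphere_sup H\<close>, the other from the tangential term through
      \<open>sphere_grad_sup H\<close>.\<close>
    have "onorm (D z) \<le> 2 * C" if "z \<in> closed_segment x y" for z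
    proof (rule onorm_bound)
      fix v
      have u: "norm (sgn z) = 1"
        using that False by (auto simp: norm_sgn)
      let ?w = "v - (v \<bullet> sgn z) *\<^sub>R sgn z"
      have "norm ((v \<bullet> sgn z) *\<^sub>R H (sgn z)) \<le> norm v * C"
        using Cauchy_Schwarz_ineq2[of v "sgn z"] u norm_le_sphere_sup[OF C1 u] C
        by (auto intro!: mult_mono)
      moreover have "norm (H' (sgn z) ?w) \<le> C * norm v"
      proof -
        have "?w \<in> sphere_tangent (sgn z)"
          using u by (simp add: sphere_tangent_def inner_diff_left dot_square_norm)
        then have "norm (H' (sgn z) ?w) \<le> sphere_grad_sup H * norm ?w"
          by (rule norm_derivative_le_sphere_grad_sup[OF C1 H' u])
        also have "\<dots> \<le> C * norm v"
          using C norm_tangent_component_le[OF u] by (intro mult_mono) auto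
        finally show ?thesis .
      qed
      ultimately show "norm (D z v) \<le> 2 * C * norm v"
        using norm_triangle_ineq[of "(v \<bullet> sgn z) *\<^sub>R H (sgn z)" "H' (sgn z) ?w"]
        unfolding D_def by (simp only: mult.commute[of "norm v" C])
    qed (use C in simp)
    then show ?thesis
      using differentiable_bound[OF convex_closed_segment der, of "2 * C" x y]
      by (simp add: C_def)
  qed
qed

section \<open>Passage to orbits and the optimal constant\<close>

lemma orbit_lipschitz_constI:
  assumes G: "group G" and \<sigma>: "\<sigma> \<in> hom G unitary_group"
    and inv: "invariant_map G \<sigma> \<Phi>" and "0 \<le> K"
    and lip: "\<And>x y. norm (\<Phi> x - \<Phi> y) \<le> K * norm (x - y)"
  shows "orbit_lipschitz_const G \<sigma> \<Phi> K"
  unfolding orbit_lipschitz_const_def induced_map_rep_orbit[OF G \<sigma> inv]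
    orbit_dist_rep_orbit[OF G \<sigma>]
proof (intro allI)
  fix x y
  have ne: "carrier G \<noteq> {}"
    using G group.is_monoid monoid.carrier_not_empty by blast
  \<comment> \<open>Replacing \<open>y\<close> by another point of its orbit leaves the left side
    unchanged, so every \<open>g\<close> gives a bound and the infimum may be taken.\<close>
  have le: "norm (\<Phi> x - \<Phi> y) \<le> K * norm (x - \<sigma> g *v y)" if "g \<in> carrier G" for g
    using lip[of x "\<sigma> g *v y"] inv that unfolding invariant_map_def by simp
  show "norm (\<Phi> x - \<Phi> y) \<le> K * (INF g\<in>carrier G. norm (x - \<sigma> g *v y))"
  \<comment> \<open>Dividing by \<open>K\<close> isolates the infimum, which requires
    \<open>K\<close> to be positive.\<close>
  proof (cases "K = 0")
    case True
    then show ?thesis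
      using lip[of x y] by simp
  next
    case False
    with \<open>0 \<le> K\<close> have "K > 0"
      by simp
    then have "norm (\<Phi> x - \<Phi> y) / K \<le> (INF g\<in>carrier G. norm (x - \<sigma> g *v y))"
      using le by (intro cINF_greatest ne) (simp add: divide_le_eq mult.commute)
    then show ?thesis
      using \<open>K > 0\<close> by (simp add: divide_le_eq mult.commute)
  qed
qed

text \<open>Each pair of orbits at positive distance bounds the admissible constants below by a
  quotient, and their infimum still satisfies all these bounds.\<close>

lemma orbit_lipschitz_const_least:
  fixes \<sigma> :: "'g \<Rightarrow> complex^'n^'n"
  assumes G: "group G" and \<sigma>: "\<sigma> \<in> hom G unitary_group"
    and K: "orbit_lipschitz_const G \<sigma> \<Phi> K"
  shows "\<exists>\<alpha>. orbit_lipschitz_const G \<sigma> \<Phi> \<alpha> \<and>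
           (\<forall>\<beta>. orbit_lipschitz_const G \<sigma> \<Phi> \<beta> \<longrightarrow> \<alpha> \<le> \<beta>)"
proof -
  define S where "S = {\<beta>. orbit_lipschitz_const G \<sigma> \<Phi> \<beta>}"
  have ne: "carrier G \<noteq> {}"
    using G group.is_monoid monoid.carrier_not_empty by blast
  obtain e :: "complex^'n" where e: "norm e = 1"
    using vector_choose_size[of 1] by auto
  \<comment> \<open>Unitary maps preserve norms, so the whole orbit of \<open>e\<close> lies at
    distance 1 from 0. This pair of orbits forces every admissible constant to be
    nonnegative.\<close>
  have "orbit_dist G \<sigma> (rep_orbit G \<sigma> 0) (rep_orbit G \<sigma> e) = 1"
    using ne by (simp add: orbit_dist_rep_orbit[OF G \<sigma>] norm_rep[OF G \<sigma>] e)
  then have "norm (induced_map \<Phi> (rep_orbit G \<sigma> 0) - induced_map \<Phi> (rep_orbit G \<sigma> e)) \<le> \<beta>"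
    if "\<beta> \<in> S" for \<beta>
    using that unfolding S_def orbit_lipschitz_const_def mem_Collect_eq
    by (metis mult.right_neutral)
  from order_trans[OF norm_ge_zero this] have bdd: "bdd_below S"
    by (intro bdd_belowI[where m=0])
  have S: "S \<noteq> {}"
    using K by (auto simp: S_def)
  have "orbit_lipschitz_const G \<sigma> \<Phi> (Inf S)"
    unfolding orbit_lipschitz_const_def
  proof (intro allI)
    fix x y
    let ?N = "norm (induced_map \<Phi> (rep_orbit G \<sigma> x) - induced_map \<Phi> (rep_orbit G \<sigma> y))"
    let ?d = "orbit_dist G \<sigma> (rep_orbit G \<sigma> x) (rep_orbit G \<sigma> y)"
    have le: "?N \<le> \<beta> * ?d" if "\<beta> \<in> S" for \<beta>
      using that unfolding S_def orbit_lipschitz_const_def by blast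
    have "0 \<le> ?d"
      unfolding orbit_dist_rep_orbit[OF G \<sigma>] by (intro cINF_greatest ne) simp
    then consider "?d = 0" | "?d > 0"
      by linarith
    then show "?N \<le> Inf S * ?d"
    proof cases
      \<comment> \<open>Any one admissible constant already forces \<open>?N\<close> to
        vanish.\<close>
      case 1
      then show ?thesis
        using S le by auto
    next
      case 2
      then have "?N / ?d \<le> Inf S"
        using le by (intro cInf_greatest S) (simp add: divide_le_eq)
      then show ?thesis
        using 2 by (simp add: divide_le_eq)
    qed
  qed
  moreover have "Inf S \<le> \<beta>" if "orbit_lipschitz_const G \<sigma> \<Phi> \<beta>" for \<beta>
    using that by (intro cInf_lower bdd) (simp add: S_def)
  ultimately show ?thesis
    by blast
qed

theorem theorem3p7:
  fixes G :: "('g, 'b) monoid_scheme"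
    and \<sigma> :: "'g \<Rightarrow> complex^'n^'n"
    and H :: "complex^'n \<Rightarrow> complex^'m"
  assumes "group G"
    and "\<sigma> \<in> hom G unitary_group"
    and "invariant_map G \<sigma> H"
    and "non_parallel G \<sigma> H"
    and "C1_map H"
  shows "(\<exists>L. L-lipschitz_on UNIV (radial_ext H)) \<and>
    (\<exists>\<alpha>. orbit_lipschitz_const G \<sigma> (radial_ext H) \<alpha> \<and>
         (\<forall>\<beta>. orbit_lipschitz_const G \<sigma> (radial_ext H) \<beta> \<longrightarrow> \<alpha> \<le> \<beta>) \<and>
         \<alpha> \<le> 3 * max (sphere_grad_sup H) (sphere_sup H))"
proof -
  define C where "C = max (sphere_grad_sup H) (sphere_sup H)"
  have C: "0 \<le> C"
    using sphere_sup_nonneg[OF assms(5)] by (simp add: C_def)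
  have lip: "norm (radial_ext H x - radial_ext H y) \<le> 2 * C * norm (x - y)" for x y
    using norm_radial_ext_diff_le[OF assms(5)] by (simp add: C_def)
  have "(2 * C)-lipschitz_on UNIV (radial_ext H)"
    using lip C by (intro lipschitz_onI) (simp_all add: dist_norm)
  moreover have K: "orbit_lipschitz_const G \<sigma> (radial_ext H) (2 * C)"
    using C lip by (intro orbit_lipschitz_constI assms(1,2)
        invariant_map_radial_ext[OF assms(1-3)]) auto
  moreover obtain \<alpha> where "orbit_lipschitz_const G \<sigma> (radial_ext H) \<alpha>"
    "\<forall>\<beta>. orbit_lipschitz_const G \<sigma> (radial_ext H) \<beta> \<longrightarrow> \<alpha> \<le> \<beta>"
    using orbit_lipschitz_const_least[OF assms(1,2) K] by blast
  moreover from this K have "\<alpha> \<le> 2 * C"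
    by blast
  \<comment> \<open>The estimate yields the sharper \<open>2 * C\<close>; nonnegativity of
    \<open>C\<close> gives the stated bound.\<close>
  then have "\<alpha> \<le> 3 * C"
    using C by simp
  ultimately show ?thesis
    unfolding C_def by blast
qed

end
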